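(* Let $\Gamma=(V,E)$ be a finite graph, $\mathbb{V}$ a real vector space of dimension $n$, and $\mathcal{M}$ the motion sheaf on $I(\Gamma)$ determined by $s$-dimensional subspaces $S_v\leq\mathbb{V}$ ($v\in V$), with $H^1(I(\Gamma),\mathcal{M})=0$. Let $d\ge 1$, $0\le k\le d$, and let $\Gamma'$ be obtained by a $d$-dimensional $k$-extension: delete edges $e_i=u_iu_i'$ ($1\le i\le k$), add a new vertex $v_*$ and edges $f_{2i-1}=u_iv_*$, $f_{2i}=u_i'v_*$ ($1\le i\le k$), $f_{2k+j}=v_jv_*$ ($1\le j\le d-k$) for vertices $v_1,\dots,v_{d-k}\in V$, such that no parallel edges are created. Let $S'_x=S_x$ for $x\in V$, let $S'_{v_*}$ be an $s$-dimensional subspace of $\mathbb{V}$, and let $\mathcal{M}'$ be the motion sheaf on $I(\Gamma')$ determined by $(S'_x)_{x\in V\cup\{v_*\}}$. Assume: (i) for all $i\in\{1,\dots,k\}$: $S'_{v_*}+S_{u_i}=S'_{v_*}+S_{u_i'}=S_{u_i}+S_{u_i'}$; (ii) for all $j\in\{1,\dots,d-k\}$: $\Big(\big(\bigcap_{i\in\{1,\dots,d-k\},\,i\neq j}(S_{v_i}+S'_{v_*})\big)\cap\big(\bigcap_{i=1}^{k}(S_{u_i}+S_{u_i'})\big)\Big)+S_{v_j}=\mathbb{V}$; (iii) for all $j\in\{1,\dots,k\}$: $\Big(\big(\bigcap_{i=1}^{d-k}(S_{v_i}+S'_{v_*})\big)\cap\big(\bigcap_{i\in\{1,\dots,k\},\,i\neq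 j}(S_{u_i}+S_{u_i'})\big)\Big)+S_{u_j}=\mathbb{V}$, where an intersection over an empty index set is $\mathbb{V}$. Then $H^1(I(\Gamma'),\mathcal{M}')=0$.
   Context: Incidence graph: for a graph (or hypergraph) $\Gamma=(V,E)$, $I(\Gamma)$ has vertex set $V\cup E$ and an edge $v\sim e$ for each $v\in e$. Motion sheaf determined by subspaces $S_v\le\mathbb{V}$: with $S(e)=\bigcap_{v\in e}S_v$, $\mathcal{M}(v)=\mathbb{V}/S_v$, $\mathcal{M}(e)=\mathbb{V}/S(e)$, $\mathcal{M}(v\sim e)=\mathbb{V}/S_v$, restriction maps the identity from $\mathcal{M}(v)$ and the reduction modulo $S_v$ from $\mathcal{M}(e)$. Sheaf cohomology on a graph: with signs $[x:i]=-[y:i]$ for each edge $i=xy$, $d:\bigoplus_{\text{vertices}}\mathcal{F}(x)\to\bigoplus_{\text{edges}}\mathcal{F}(i)$, $d(w)_i=\sum_{x\in i}[x:i]r^x_i(w_x)$, $H^0=\ker d$, $H^1=\operatorname{coker}d$. *)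

theory Defs
  imports Complex_Main "HOL-Library.FuncSet" "HOL-Library.Set_Algebras"
    "HOL-Algebra.AbelCoset" "HOL-Algebra.Module"
begin

section \<open>Graphs, incidence graphs and k-extensions\<close>

record 'a graph =
  verts :: "'a set"
  edges :: "'a set set"

definition finite_graph :: "'a graph \<Rightarrow> bool" where
  "finite_graph G \<longleftrightarrow> finite (verts G) \<and> (\<forall>e\<in>edges G. e \<subseteq> verts G \<and> card e = 2)"

text \<open>The incidence graph lives on the disjoint sum: \<open>Inl v\<close> is a vertex and \<open>Inr e\<close> an edge
  of the given (hyper)graph.\<close>

definition incidence_graph :: "'a graph \<Rightarrow> ('a + 'a set) graph" where
  "incidence_graph G =
     \<lparr>verts = Inl ` verts G \<union> Inr ` edges G,
      edges = {{Inl v, Inr e} | v e. e \<in> edges G \<and> v \<in> e}\<rparr>"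

text \<open>The new edges: \<open>f (2 * i - 1)\<close> and \<open>f (2 * i)\<close> join \<open>vs\<close> to the two ends of the
  deleted edge \<open>{u i, u' i}\<close>, and \<open>f (2 * k + j)\<close> joins \<open>vs\<close> to \<open>v j\<close>.\<close>

definition extension_edge ::
    "nat \<Rightarrow> (nat \<Rightarrow> 'a) \<Rightarrow> (nat \<Rightarrow> 'a) \<Rightarrow> (nat \<Rightarrow> 'a) \<Rightarrow> 'a \<Rightarrow> nat \<Rightarrow> 'a set" where
  "extension_edge k u u' v vs m =
     (if m \<le> 2 * k then (if odd m then {u ((m + 1) div 2), vs} else {u' (m div 2), vs})
      else {v (m - 2 * k), vs})"

text \<open>As the new vertex is not in \<open>G\<close>, the only parallel edges that could arise are two
  coinciding edges among the \<open>d + k\<close> new ones, which is what \<open>inj_on\<close> excludes. In particular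
  the \<open>k\<close> deleted edges are pairwise distinct.\<close>

definition k_extension ::
    "nat \<Rightarrow> nat \<Rightarrow> (nat \<Rightarrow> 'a) \<Rightarrow> (nat \<Rightarrow> 'a) \<Rightarrow> (nat \<Rightarrow> 'a) \<Rightarrow> 'a \<Rightarrow> 'a graph \<Rightarrow> 'a graph \<Rightarrow> bool" where
  "k_extension d k u u' v vs G G' \<longleftrightarrow>
     (\<forall>i\<in>{1..k}. {u i, u' i} \<in> edges G) \<and>
     (\<forall>j\<in>{1..d - k}. v j \<in> verts G) \<and>
     vs \<notin> verts G \<and>
     inj_on (extension_edge k u u' v vs) {1..d + k} \<and>
     verts G' = insert vs (verts G) \<and>
     edges G' = (edges G - (\<lambda>i. {u i, u' i}) ` {1..k})
                 \<union> extension_edge k u u' v vs ` {1..d + k}"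

section \<open>Real vector spaces as objects\<close>

text \<open>The stalks of a sheaf are different vector spaces, so they are represented as module
  records over the field of reals. The components \<open>mult\<close> and \<open>one\<close> of these records have no
  meaning (the locale \<open>module\<close> does not constrain them) and are filled with dummy values.\<close>

definition real_field :: "real ring" where
  "real_field = \<lparr>carrier = UNIV, mult = (*), one = 1, zero = 0, add = (+)\<rparr>"

definition ambient :: "(real, 'v::real_vector) module" where
  "ambient = \<lparr>carrier = UNIV, mult = (\<lambda>_ _. 0), one = 0, zero = 0, add = (+), smult = scaleR\<rparr>"

text \<open>The quotient of \<open>M\<close> by a subspace \<open>N\<close> consists of the cosets of \<open>N\<close>. Adding \<open>N\<close>
  again after scaling is needed for the scalar \<open>0\<close>.\<close>

definition quotient_module :: "(real, 'm) module \<Rightarrow> 'm set \<Rightarrow> (real, 'm set) module" where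
  "quotient_module M N =
     \<lparr>carrier = a_rcosets\<^bsub>M\<^esub> N, mult = (\<lambda>_ _. N), one = N, zero = N, add = set_add M,
      smult = (\<lambda>c A. N <+>\<^bsub>M\<^esub> ((\<lambda>x. c \<odot>\<^bsub>M\<^esub> x) ` A))\<rparr>"

text \<open>For finite index sets only, where direct sum and direct product coincide.\<close>

definition direct_sum :: "'i set \<Rightarrow> ('i \<Rightarrow> (real, 'm) module) \<Rightarrow> (real, 'i \<Rightarrow> 'm) module" where
  "direct_sum I M =
     \<lparr>carrier = (\<Pi>\<^sub>E i\<in>I. carrier (M i)),
      mult = (\<lambda>_ _. \<lambda>i\<in>I. \<zero>\<^bsub>M i\<^esub>), one = (\<lambda>i\<in>I. \<zero>\<^bsub>M i\<^esub>),
      zero = (\<lambda>i\<in>I. \<zero>\<^bsub>M i\<^esub>),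
      add = (\<lambda>f g. \<lambda>i\<in>I. f i \<oplus>\<^bsub>M i\<^esub> g i),
      smult = (\<lambda>c f. \<lambda>i\<in>I. c \<odot>\<^bsub>M i\<^esub> f i)\<rparr>"

section \<open>Sheaves on graphs and their cohomology\<close>

text \<open>\<open>restriction F x i\<close> is the restriction map from the stalk at the vertex \<open>x\<close> to the stalk
  at an edge \<open>i\<close> containing \<open>x\<close>.\<close>

record ('x, 'm) sheaf =
  vstalk :: "'x \<Rightarrow> (real, 'm) module"
  estalk :: "'x set \<Rightarrow> (real, 'm) module"
  restriction :: "'x \<Rightarrow> 'x set \<Rightarrow> 'm \<Rightarrow> 'm"

definition incidence_signs :: "'x graph \<Rightarrow> ('x \<Rightarrow> 'x set \<Rightarrow> real) \<Rightarrow> bool" where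
  "incidence_signs X sg \<longleftrightarrow>
     (\<forall>i\<in>edges X. (\<forall>x\<in>i. sg x i \<in> {1, -1}) \<and> (\<forall>x\<in>i. \<forall>y\<in>i. x \<noteq> y \<longrightarrow> sg x i = - sg y i))"

definition C0 :: "'x graph \<Rightarrow> ('x, 'm) sheaf \<Rightarrow> (real, 'x \<Rightarrow> 'm) module" where
  "C0 X F = direct_sum (verts X) (vstalk F)"

definition C1 :: "'x graph \<Rightarrow> ('x, 'm) sheaf \<Rightarrow> (real, 'x set \<Rightarrow> 'm) module" where
  "C1 X F = direct_sum (edges X) (estalk F)"

definition coboundary ::
    "'x graph \<Rightarrow> ('x \<Rightarrow> 'x set \<Rightarrow> real) \<Rightarrow> ('x, 'm) sheaf \<Rightarrow> ('x \<Rightarrow> 'm) \<Rightarrow> ('x set \<Rightarrow> 'm)" where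
  "coboundary X sg F w =
     (\<lambda>i\<in>edges X. \<Oplus>\<^bsub>estalk F i\<^esub>x\<in>i. sg x i \<odot>\<^bsub>estalk F i\<^esub> restriction F x i (w x))"

definition H1 ::
    "'x graph \<Rightarrow> ('x \<Rightarrow> 'x set \<Rightarrow> real) \<Rightarrow> ('x, 'm) sheaf \<Rightarrow> (real, ('x set \<Rightarrow> 'm) set) module" where
  "H1 X sg F = quotient_module (C1 X F) (coboundary X sg F ` carrier (C0 X F))"

definition zero_module :: "(real, 'm) module \<Rightarrow> bool" where
  "zero_module M \<longleftrightarrow> carrier M = {\<zero>\<^bsub>M\<^esub>}"

section \<open>Motion sheaves\<close>

definition edge_space :: "('a \<Rightarrow> 'v::real_vector set) \<Rightarrow> 'a set \<Rightarrow> 'v set" where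
  "edge_space S e = (\<Inter>v\<in>e. S v)"

text \<open>The end of an edge \<open>{Inl v, Inr e}\<close> of the incidence graph that is a vertex of the
  original graph.\<close>

definition base_vertex :: "('a + 'a set) set \<Rightarrow> 'a" where
  "base_vertex i = (THE v. Inl v \<in> i)"

text \<open>Reduction modulo \<open>S v\<close> sends the coset of \<open>x\<close> modulo \<open>edge_space S e\<close> to the coset of
  \<open>x\<close> modulo \<open>S v\<close>, that is, it adds \<open>S v\<close>; see \<open>reduction_coset\<close> below.\<close>

definition motion_sheaf :: "('a \<Rightarrow> 'v::real_vector set) \<Rightarrow> ('a + 'a set, 'v set) sheaf" where
  "motion_sheaf S =
     \<lparr>vstalk = (\<lambda>x. case x of Inl v \<Rightarrow> quotient_module ambient (S v)
                            | Inr e \<Rightarrow> quotient_module ambient (edge_space S e)),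
      estalk = (\<lambda>i. quotient_module ambient (S (base_vertex i))),
      restriction = (\<lambda>x i A. case x of Inl v \<Rightarrow> A | Inr e \<Rightarrow> S (base_vertex i) <+>\<^bsub>ambient\<^esub> A)\<rparr>"

section \<open>Sanity checks\<close>

lemma base_vertex_edge [simp]: "base_vertex {Inl v, Inr e} = v"
  by (auto simp: base_vertex_def)

lemma carrier_quotient_ambient:
  "carrier (quotient_module ambient W) = range (\<lambda>x::'v::real_vector. x +o W)"
proof -
  have "W +>\<^bsub>ambient\<^esub> x = x +o W" for x
    by (auto simp: a_r_coset_def' ambient_def elt_set_plus_def add.commute)
  then show ?thesis
    by (auto simp: quotient_module_def A_RCOSETS_def RCOSETS_def a_r_coset_def[symmetric])
      (auto simp: ambient_def)
qed

lemma set_add_ambient: "A <+>\<^bsub>ambient\<^esub> B = A + (B :: 'v::real_vector set)"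
  by (auto simp: set_add_defs ambient_def set_plus_def)

lemma smult_ambient: "c \<odot>\<^bsub>ambient\<^esub> x = c *\<^sub>R x"
  by (simp add: ambient_def)

lemma subspace_plus_subset:
  fixes W U :: "'v::real_vector set"
  assumes "subspace W" "subspace U" "U \<subseteq> W"
  shows "W + U = W"
proof
  show "W + U \<subseteq> W" using assms subspace_add[of W] by (auto simp: set_plus_def)
  show "W \<subseteq> W + U"
    using set_zero_plus2[OF subspace_0[OF assms(2)], of W] by (simp add: add.commute)
qed

lemma reduction_coset:
  fixes S :: "'a \<Rightarrow> 'v::real_vector set"
  assumes "\<And>v. v \<in> e \<Longrightarrow> subspace (S v)" "v \<in> e"
  shows "restriction (motion_sheaf S) (Inr e) {Inl v, Inr e} (x +o edge_space S e) = x +o S v"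
proof -
  have "S v + edge_space S e = S v"
    using assms by (intro subspace_plus_subset) (auto simp: edge_space_def intro!: subspace_Inter)
  then show ?thesis
    by (simp add: motion_sheaf_def set_add_ambient set_plus_rearranges)
qed

lemma cring_real_field: "cring real_field"
proof (rule cringI)
  show "abelian_group real_field"
  proof (rule abelian_groupI)
    fix x :: real
    show "\<exists>y\<in>carrier real_field. y \<oplus>\<^bsub>real_field\<^esub> x = \<zero>\<^bsub>real_field\<^esub>"
      by (intro bexI[of _ "- x"]) (simp_all add: real_field_def)
  qed (auto simp: real_field_def)
  show "comm_monoid real_field"
    by (rule comm_monoidI) (auto simp: real_field_def)
qed (auto simp: real_field_def algebra_simps)

lemma module_quotient_ambient:
  fixes W :: "'v::real_vector set"
  assumes W: "subspace W"
  shows "module real_field (quotient_module ambient W)"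
proof -
  let ?Q = "quotient_module ambient W"
  have WW: "W + W = W" by (rule subspace_plus_subset) (use W in auto)
  have car: "carrier ?Q = range (\<lambda>x. x +o W)" by (rule carrier_quotient_ambient)
  have add: "(x +o W) \<oplus>\<^bsub>?Q\<^esub> (y +o W) = (x + y) +o W" for x y
    by (simp add: quotient_module_def set_add_ambient set_plus_rearranges WW add.commute)
  have zero: "\<zero>\<^bsub>?Q\<^esub> = 0 +o W" by (simp add: quotient_module_def)
  have smult: "c \<odot>\<^bsub>?Q\<^esub> (x +o W) = (c *\<^sub>R x) +o W" for c x
  proof -
    have "W + (\<lambda>w. c *\<^sub>R w) ` W = W"
    proof (rule subspace_plus_subset)
      show "subspace ((\<lambda>w. c *\<^sub>R w) ` W)"
        by (intro linear_subspace_image linear_scaleR W)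
      show "(\<lambda>w. c *\<^sub>R w) ` W \<subseteq> W" using W by (auto intro: subspace_scale)
    qed (rule W)
    moreover have "(\<lambda>y. c *\<^sub>R y) ` (x +o W) = (c *\<^sub>R x) +o (\<lambda>w. c *\<^sub>R w) ` W"
      by (force simp: elt_set_plus_def image_iff scaleR_add_right)
    ultimately show ?thesis
      by (simp add: quotient_module_def set_add_ambient smult_ambient set_plus_rearranges)
  qed
  show ?thesis
  proof (rule moduleI)
    show "abelian_group ?Q"
    proof (rule abelian_groupI)
      fix A assume "A \<in> carrier ?Q"
      then obtain x where "A = x +o W" by (auto simp: car)
      then have "(- x +o W) \<oplus>\<^bsub>?Q\<^esub> A = \<zero>\<^bsub>?Q\<^esub>" by (simp add: add zero)
      then show "\<exists>B\<in>carrier ?Q. B \<oplus>\<^bsub>?Q\<^esub> A = \<zero>\<^bsub>?Q\<^esub>" by (auto simp: car)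
    qed (auto simp: car add zero algebra_simps simp del: set_zero_plus)
  qed (rule cring_real_field, auto simp: car add smult real_field_def algebra_simps)
qed

end

(* Lifting cosets to the ambient space, the vanishing of H1 says that every family of vectors
   b x e, for x \<in> e, can be written as p x - q e modulo S x. To transfer this to the extension,
   impose on a deleted edge {u i, u' i} the differences prescribed by the two new edges at vs;
   as the three pairwise sums of S (u i), S (u' i), S' vs agree, the two conditions on p vs coming
   from this pair then collapse into one. The remaining d affine conditions on p vs are
   simultaneously solvable by (ii) and (iii), as in the Chinese remainder theorem. *)

theory Submission
  imports Defs
begin

section \<open>Cosets of subspaces\<close>

lemma coset_eq_iff:
  fixes W :: "'v::real_vector set"
  assumes W: "subspace W"
  shows "x +o W = y +o W \<longleftrightarrow> x - y \<in> W"
proof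
  assume "x +o W = y +o W"
  moreover have "x \<in> x +o W"
    using subspace_0[OF W] by (force simp: elt_set_plus_def)
  ultimately show "x - y \<in> W" by (auto simp: elt_set_plus_def)
next
  assume d: "x - y \<in> W"
  have "a +o W \<subseteq> b +o W" if ab: "a - b \<in> W" for a b :: 'v
  proof
    fix z assume "z \<in> a +o W"
    then obtain w where "w \<in> W" "z = a + w" by (auto simp: elt_set_plus_def)
    then have "z = b + ((a - b) + w)" "(a - b) + w \<in> W"
      using ab subspace_add[OF W] by auto
    then show "z \<in> b +o W" unfolding elt_set_plus_def by blast
  qed
  moreover have "y - x \<in> W" using subspace_neg[OF W d] by simp
  ultimately show "x +o W = y +o W" using d by blast
qed

lemma quotient_ambient_add:
  fixes W :: "'v::real_vector set"
  assumes W: "subspace W"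
  shows "(x +o W) \<oplus>\<^bsub>quotient_module ambient W\<^esub> (y +o W) = (x + y) +o W"
proof -
  have "W + W = W" by (rule subspace_plus_subset) (use W in auto)
  then show ?thesis
    by (simp add: quotient_module_def set_add_ambient set_plus_rearranges add.commute)
qed

lemma quotient_ambient_smult:
  fixes W :: "'v::real_vector set"
  assumes W: "subspace W"
  shows "c \<odot>\<^bsub>quotient_module ambient W\<^esub> (x +o W) = (c *\<^sub>R x) +o W"
proof -
  have "W + (\<lambda>w. c *\<^sub>R w) ` W = W"
  proof (rule subspace_plus_subset)
    show "subspace ((\<lambda>w. c *\<^sub>R w) ` W)"
      by (intro linear_subspace_image linear_scaleR W)
    show "(\<lambda>w. c *\<^sub>R w) ` W \<subseteq> W" using W by (auto intro: subspace_scale)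
  qed (rule W)
  moreover have "(\<lambda>y. c *\<^sub>R y) ` (x +o W) = (c *\<^sub>R x) +o (\<lambda>w. c *\<^sub>R w) ` W"
    by (force simp: elt_set_plus_def image_iff scaleR_add_right)
  ultimately show ?thesis
    by (simp add: quotient_module_def set_add_ambient smult_ambient set_plus_rearranges)
qed

text \<open>Writing \<open>a - b = s + t\<close> with \<open>s\<close> in \<open>A\<close> and
  \<open>t\<close> in \<open>B\<close>, the vector \<open>q = a - s\<close> works. This criterion
  for two cosets to meet eliminates the unknown attached to a single new edge.\<close>

lemma common_point_of_cosets:
  fixes A B :: "'v::real_vector set"
  assumes "subspace B" and "a - b \<in> A + B"
  shows "\<exists>q. a - q \<in> A \<and> b - q \<in> B"
proof -
  obtain s t where st: "s \<in> A" "t \<in> B" "a - b = s + t"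
    using assms(2) by (auto simp: set_plus_def)
  have "b - (a - s) = - t" using st(3) by (simp add: algebra_simps)
  then have "a - (a - s) \<in> A \<and> b - (a - s) \<in> B"
    using st subspace_neg[OF assms(1) st(2)] by simp
  then show ?thesis by blast
qed

lemma subspace_set_plus:
  fixes A B :: "'v::real_vector set"
  assumes "subspace A" "subspace B"
  shows "subspace (A + B)"
proof -
  have "A + B = {x + y | x y. x \<in> A \<and> y \<in> B}" by (auto simp: set_plus_def)
  then show ?thesis using subspace_sums[OF assms] by simp
qed

text \<open>Chinese remainder argument: \<open>cov\<close> splits \<open>x a\<close> into some
  \<open>z a\<close> that vanishes modulo every other \<open>W b\<close>, plus an element of
  \<open>W a\<close>. Modulo \<open>W a\<close> only the summand \<open>z a\<close> of the sum of
  all \<open>z b\<close> survives, so this sum meets every condition.\<close>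

lemma simultaneous_cosets:
  fixes W :: "'i \<Rightarrow> 'v::real_vector set"
  assumes fin: "finite A"
    and sub: "\<And>a. a \<in> A \<Longrightarrow> subspace (W a)"
    and cov: "\<And>a. a \<in> A \<Longrightarrow> (\<Inter>b\<in>A - {a}. W b) + W a = UNIV"
  shows "\<exists>y. \<forall>a\<in>A. x a - y \<in> W a"
proof -
  have "\<exists>z. (\<forall>b\<in>A - {a}. z \<in> W b) \<and> x a - z \<in> W a" if "a \<in> A" for a
  proof -
    have "x a \<in> (\<Inter>b\<in>A - {a}. W b) + W a" using cov[OF that] by simp
    then obtain z w where zw: "z \<in> (\<Inter>b\<in>A - {a}. W b)" "w \<in> W a" "x a = z + w"
      by (auto simp: set_plus_def)
    have "x a - z = w" using zw(3) by simp
    with zw(1,2) show ?thesis by auto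
  qed
  then obtain z where z: "\<And>a b. a \<in> A \<Longrightarrow> b \<in> A - {a} \<Longrightarrow> z a \<in> W b"
      "\<And>a. a \<in> A \<Longrightarrow> x a - z a \<in> W a"
    by metis
  have "x a - (\<Sum>b\<in>A. z b) \<in> W a" if a: "a \<in> A" for a
  proof -
    have "(\<Sum>b\<in>A - {a}. z b) \<in> W a"
      using z(1) a by (intro subspace_sum sub) auto
    then have "(x a - z a) - (\<Sum>b\<in>A - {a}. z b) \<in> W a"
      by (rule subspace_diff[OF sub[OF a] z(2)[OF a]])
    then show ?thesis by (simp add: sum.remove[OF fin a] algebra_simps)
  qed
  then show ?thesis by blast
qed

section \<open>Vanishing of the first cohomology of a motion sheaf\<close>

text \<open>Represents a 1-cochain by ambient vectors, one per incidence \<open>i\<close>, each read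
  modulo \<open>S (base_vertex i)\<close>. The restriction to the edge set matches the extensional
  functions that form the carrier of \<open>direct_sum\<close>.\<close>

definition class_cochain ::
    "'a graph \<Rightarrow> ('a \<Rightarrow> 'v::real_vector set) \<Rightarrow> (('a + 'a set) set \<Rightarrow> 'v) \<Rightarrow>
      ('a + 'a set) set \<Rightarrow> 'v set" where
  "class_cochain G S b = (\<lambda>i\<in>edges (incidence_graph G). b i +o S (base_vertex i))"

lemma incidence_edgeE:
  assumes "i \<in> edges (incidence_graph G)"
  obtains x e where "e \<in> edges G" "x \<in> e" "i = {Inl x, Inr e}"
  using assms by (auto simp: incidence_graph_def)

lemma incidence_edgeI: "e \<in> edges G \<Longrightarrow> x \<in> e \<Longrightarrow> {Inl x, Inr e} \<in> edges (incidence_graph G)"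
  by (auto simp: incidence_graph_def)

lemma carrier_C1_motion:
  "carrier (C1 (incidence_graph G) (motion_sheaf S)) = range (class_cochain G S)"
proof
  show "range (class_cochain G S) \<subseteq> carrier (C1 (incidence_graph G) (motion_sheaf S))"
    by (auto simp: C1_def direct_sum_def motion_sheaf_def class_cochain_def
        carrier_quotient_ambient)
next
  show "carrier (C1 (incidence_graph G) (motion_sheaf S)) \<subseteq> range (class_cochain G S)"
  proof
    fix f assume f: "f \<in> carrier (C1 (incidence_graph G) (motion_sheaf S))"
    then have "\<forall>i\<in>edges (incidence_graph G). \<exists>y. f i = y +o S (base_vertex i)"
      by (auto simp: C1_def direct_sum_def motion_sheaf_def carrier_quotient_ambient PiE_iff)
    then obtain b where "\<forall>i\<in>edges (incidence_graph G). f i = b i +o S (base_vertex i)"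
      by metis
    moreover have "f \<in> extensional (edges (incidence_graph G))"
      using f by (simp add: C1_def direct_sum_def PiE_iff)
    ultimately have "f = class_cochain G S b"
      unfolding class_cochain_def by (intro extensionalityI[of f]) auto
    then show "f \<in> range (class_cochain G S)" by blast
  qed
qed

lemma C1_motion_add:
  assumes sub: "\<And>e x. e \<in> edges G \<Longrightarrow> x \<in> e \<Longrightarrow> subspace (S x)"
  shows "class_cochain G S a \<oplus>\<^bsub>C1 (incidence_graph G) (motion_sheaf S)\<^esub> class_cochain G S b
    = class_cochain G S (\<lambda>i. a i + b i)"
proof -
  have "subspace (S (base_vertex i))" if "i \<in> edges (incidence_graph G)" for i
    using that sub by (auto elim!: incidence_edgeE)
  then show ?thesis
    by (simp add: C1_def direct_sum_def class_cochain_def motion_sheaf_def quotient_ambient_add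
        cong: restrict_cong)
qed

text \<open>The zero of the quotient is \<open>B\<close> itself, and its carrier consists of the
  translates of \<open>B\<close>. If \<open>B\<close> is the only translate, then translating the
  zero cochain, which lies in \<open>B\<close>, puts every class cochain into \<open>B\<close>.
  Conversely, the set of all class cochains is mapped onto itself by each translation.\<close>

lemma H1_motion_zero_iff_surj:
  fixes G :: "'a graph" and S :: "'a \<Rightarrow> 'v::real_vector set"
    and sg :: "'a + 'a set \<Rightarrow> ('a + 'a set) set \<Rightarrow> real"
  defines "B \<equiv> coboundary (incidence_graph G) sg (motion_sheaf S)
      ` carrier (C0 (incidence_graph G) (motion_sheaf S))"
  assumes sub: "\<And>e x. e \<in> edges G \<Longrightarrow> x \<in> e \<Longrightarrow> subspace (S x)"
    and zeroB: "class_cochain G S (\<lambda>_. 0) \<in> B" and Bsub: "B \<subseteq> range (class_cochain G S)"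
  shows "zero_module (H1 (incidence_graph G) sg (motion_sheaf S)) \<longleftrightarrow>
    range (class_cochain G S) \<subseteq> B"
proof -
  let ?C = "C1 (incidence_graph G) (motion_sheaf S)"
  have cosets: "carrier (H1 (incidence_graph G) sg (motion_sheaf S))
      = (\<lambda>b. (\<lambda>f. f \<oplus>\<^bsub>?C\<^esub> class_cochain G S b) ` B) ` UNIV"
    by (auto simp: H1_def quotient_module_def A_RCOSETS_def RCOSETS_def r_coset_def
        carrier_C1_motion B_def)
  have zero: "\<zero>\<^bsub>H1 (incidence_graph G) sg (motion_sheaf S)\<^esub> = B"
    by (simp add: H1_def quotient_module_def B_def)
  show ?thesis
  proof
    assume "zero_module (H1 (incidence_graph G) sg (motion_sheaf S))"
    moreover have "(\<lambda>f. f \<oplus>\<^bsub>?C\<^esub> class_cochain G S b) ` B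
        \<in> carrier (H1 (incidence_graph G) sg (motion_sheaf S))" for b
      unfolding cosets by (rule rangeI)
    ultimately have eq: "(\<lambda>f. f \<oplus>\<^bsub>?C\<^esub> class_cochain G S b) ` B = B" for b
      by (simp add: zero_module_def zero)
    have "class_cochain G S b \<in> B" for b
    proof -
      have "class_cochain G S (\<lambda>_. 0) \<oplus>\<^bsub>?C\<^esub> class_cochain G S b \<in> B"
        using eq[of b] zeroB by blast
      then show ?thesis by (simp add: C1_motion_add[of G S, OF sub])
    qed
    then show "range (class_cochain G S) \<subseteq> B" by blast
  next
    assume "range (class_cochain G S) \<subseteq> B"
    then have Brange: "B = range (class_cochain G S)" using Bsub by blast
    have "(\<lambda>f. f \<oplus>\<^bsub>?C\<^esub> class_cochain G S b) ` B = B" for b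
    proof -
      have add: "class_cochain G S a \<oplus>\<^bsub>?C\<^esub> class_cochain G S b
          = class_cochain G S (\<lambda>i. a i + b i)" for a
        by (rule C1_motion_add[OF sub])
      \<comment> \<open>Translation by the class of \<open>b\<close> hits the class of
        \<open>a\<close> at the class represented by \<open>a - b\<close>.\<close>
      have "class_cochain G S a \<in> (\<lambda>f. f \<oplus>\<^bsub>?C\<^esub> class_cochain G S b) ` B" for a
        unfolding Brange
        by (rule image_eqI[of _ _ "class_cochain G S (\<lambda>i. a i - b i)"]) (simp_all add: add)
      then show ?thesis
        unfolding Brange by (auto simp: add)
    qed
    then show "zero_module (H1 (incidence_graph G) sg (motion_sheaf S))"
      by (simp add: zero_module_def cosets zero)
  qed
qed

text \<open>As the two signs on an edge of the incidence graph are opposite, only the sign at its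
  \<open>Inl\<close> end appears.\<close>

lemma coboundary_motion:
  fixes S :: "'a \<Rightarrow> 'v::real_vector set"
  assumes sub: "\<And>e x. e \<in> edges G \<Longrightarrow> x \<in> e \<Longrightarrow> subspace (S x)"
    and sg: "incidence_signs (incidence_graph G) sg"
    and w: "\<And>e x. e \<in> edges G \<Longrightarrow> x \<in> e \<Longrightarrow> w (Inl x) = p x +o S x"
      "\<And>e. e \<in> edges G \<Longrightarrow> w (Inr e) = q e +o edge_space S e"
    and e: "e \<in> edges G" "x \<in> e"
  shows "coboundary (incidence_graph G) sg (motion_sheaf S) w {Inl x, Inr e}
    = (sg (Inl x) {Inl x, Inr e} *\<^sub>R (p x - q e)) +o S x"
proof -
  let ?i = "{Inl x, Inr e} :: ('a + 'a set) set"
  let ?Q = "quotient_module ambient (S x)"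
  have Sx: "subspace (S x)" using sub e by blast
  interpret Q: abelian_group ?Q
    using module_quotient_ambient[OF Sx] by (rule module.axioms(2))
  have st: "estalk (motion_sheaf S) ?i = ?Q" by (simp add: motion_sheaf_def)
  have l: "restriction (motion_sheaf S) (Inl x) ?i (w (Inl x)) = p x +o S x"
    using w(1)[OF e] by (simp add: motion_sheaf_def)
  have r: "restriction (motion_sheaf S) (Inr e) ?i (w (Inr e)) = q e +o S x"
    using w(2)[OF e(1)] reduction_coset[of e S x "q e"] sub e by simp
  have neg: "sg (Inr e) ?i = - sg (Inl x) ?i"
  proof -
    have "\<forall>x\<in>?i. \<forall>y\<in>?i. x \<noteq> y \<longrightarrow> sg x ?i = - sg y ?i"
      using sg incidence_edgeI[OF e] unfolding incidence_signs_def by blast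
    from this[rule_format, of "Inr e" "Inl x"] show ?thesis by simp
  qed
  have car: "y +o S x \<in> carrier ?Q" for y by (auto simp: carrier_quotient_ambient)
  have "coboundary (incidence_graph G) sg (motion_sheaf S) w ?i
      = (\<Oplus>\<^bsub>?Q\<^esub>y\<in>?i. sg y ?i \<odot>\<^bsub>?Q\<^esub> restriction (motion_sheaf S) y ?i (w y))"
    using incidence_edgeI[OF e] by (simp add: coboundary_def st)
  also have "\<dots> = (sg (Inl x) ?i *\<^sub>R p x) +o S x \<oplus>\<^bsub>?Q\<^esub> (sg (Inr e) ?i *\<^sub>R q e) +o S x"
    by (subst Q.finsum_insert) (auto simp: l r quotient_ambient_smult[OF Sx] car)
  also have "\<dots> = (sg (Inl x) ?i *\<^sub>R (p x - q e)) +o S x"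
    by (simp add: quotient_ambient_add[OF Sx] neg algebra_simps)
  finally show ?thesis .
qed

text \<open>Turns cohomology into linear algebra with representatives. The subspaces
  \<open>edge_space S e\<close> drop out because changing \<open>q e\<close> within one of them
  changes \<open>p x - q e\<close> only within \<open>S x\<close>. The signs drop out because they
  can be absorbed into the arbitrary family \<open>b\<close>.\<close>

lemma H1_motion_zero_iff:
  fixes S :: "'a \<Rightarrow> 'v::real_vector set"
  assumes ev: "\<And>e. e \<in> edges G \<Longrightarrow> e \<subseteq> verts G"
    and sv: "\<And>x. x \<in> verts G \<Longrightarrow> subspace (S x)"
    and sg: "incidence_signs (incidence_graph G) sg"
  shows "zero_module (H1 (incidence_graph G) sg (motion_sheaf S)) \<longleftrightarrow>
    (\<forall>b. \<exists>p q. \<forall>e\<in>edges G. \<forall>x\<in>e. p x - q e - b x e \<in> S x)"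
proof -
  let ?I = "incidence_graph G" and ?M = "motion_sheaf S"
  let ?s = "\<lambda>x e. sg (Inl x) {Inl x, Inr e}"
  let ?B = "coboundary ?I sg ?M ` carrier (C0 ?I ?M)"
  let ?w = "\<lambda>p q. \<lambda>y\<in>verts ?I. case y of Inl x \<Rightarrow> p x +o S x | Inr e \<Rightarrow> q e +o edge_space S e"
  have sub: "subspace (S x)" if "e \<in> edges G" "x \<in> e" for e x
    using ev sv that by blast
  have s1: "?s x e \<in> {1, -1}" if "e \<in> edges G" "x \<in> e" for x e
    using sg incidence_edgeI[OF that] unfolding incidence_signs_def by blast
  have wC: "?w p q \<in> carrier (C0 ?I ?M)" for p q
    by (auto simp: C0_def direct_sum_def motion_sheaf_def carrier_quotient_ambient
        incidence_graph_def)
  have wl: "?w p q (Inl x) = p x +o S x" if "e \<in> edges G" "x \<in> e" for p q e x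
    using that ev by (auto simp: incidence_graph_def)
  have wr: "?w p q (Inr e) = q e +o edge_space S e" if "e \<in> edges G" for p q e
    using that by (auto simp: incidence_graph_def)
  \<comment> \<open>Both functions are \<open>undefined\<close> off the edges of \<open>?I\<close>,
    so they need comparing only on incidences.\<close>
  have ext: "coboundary ?I sg ?M w = class_cochain G S b \<longleftrightarrow>
      (\<forall>e\<in>edges G. \<forall>x\<in>e. coboundary ?I sg ?M w {Inl x, Inr e} = b {Inl x, Inr e} +o S x)"
    for w b
  proof
    assume R: "\<forall>e\<in>edges G. \<forall>x\<in>e. coboundary ?I sg ?M w {Inl x, Inr e} = b {Inl x, Inr e} +o S x"
    show "coboundary ?I sg ?M w = class_cochain G S b"
    proof
      fix i show "coboundary ?I sg ?M w i = class_cochain G S b i"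
      proof (cases "i \<in> edges ?I")
        case True
        then obtain x e where "e \<in> edges G" "x \<in> e" "i = {Inl x, Inr e}"
          by (rule incidence_edgeE)
        then show ?thesis using R True by (simp add: class_cochain_def)
      qed (simp add: coboundary_def class_cochain_def)
    qed
  qed (auto simp: class_cochain_def incidence_edgeI)
  have cob: "coboundary ?I sg ?M w = class_cochain G S b \<longleftrightarrow>
      (\<forall>e\<in>edges G. \<forall>x\<in>e. ?s x e *\<^sub>R (p x - q e) - b {Inl x, Inr e} \<in> S x)"
    if "\<And>e x. e \<in> edges G \<Longrightarrow> x \<in> e \<Longrightarrow> w (Inl x) = p x +o S x"
      "\<And>e. e \<in> edges G \<Longrightarrow> w (Inr e) = q e +o edge_space S e" for w p q b
  proof -
    have "coboundary ?I sg ?M w {Inl x, Inr e} = b {Inl x, Inr e} +o S x \<longleftrightarrow>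
        ?s x e *\<^sub>R (p x - q e) - b {Inl x, Inr e} \<in> S x" if e: "e \<in> edges G" "x \<in> e" for e x
      using coboundary_motion[of G S sg w p q e x] coset_eq_iff[OF sub[OF e]] sub sg e
        \<open>\<And>e x. e \<in> edges G \<Longrightarrow> x \<in> e \<Longrightarrow> w (Inl x) = p x +o S x\<close>
        \<open>\<And>e. e \<in> edges G \<Longrightarrow> w (Inr e) = q e +o edge_space S e\<close> by simp
    then show ?thesis unfolding ext by (intro ball_cong refl)
  qed
  \<comment> \<open>Choice of a representative for each component of a 0-cochain. Vertices on no
    edge can be ignored, since the coboundary does not see them.\<close>
  have rep: "\<exists>p q. (\<forall>e\<in>edges G. \<forall>x\<in>e. w (Inl x) = p x +o S x) \<and>
      (\<forall>e\<in>edges G. w (Inr e) = q e +o edge_space S e)" if "w \<in> carrier (C0 ?I ?M)" for w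
  proof -
    have w: "w y \<in> carrier (vstalk ?M y)" if "y \<in> verts ?I" for y
      using \<open>w \<in> carrier (C0 ?I ?M)\<close> that by (auto simp: C0_def direct_sum_def)
    have 1: "\<forall>x\<in>verts G. \<exists>y. w (Inl x) = y +o S x"
    proof
      fix x assume "x \<in> verts G"
      then show "\<exists>y. w (Inl x) = y +o S x"
        using w[of "Inl x"]
        by (auto simp: motion_sheaf_def carrier_quotient_ambient incidence_graph_def)
    qed
    have 2: "\<forall>e\<in>edges G. \<exists>y. w (Inr e) = y +o edge_space S e"
    proof
      fix e assume "e \<in> edges G"
      then show "\<exists>y. w (Inr e) = y +o edge_space S e"
        using w[of "Inr e"]
        by (auto simp: motion_sheaf_def carrier_quotient_ambient incidence_graph_def)
    qed
    show ?thesis using bchoice[OF 1] bchoice[OF 2] ev by blast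
  qed
  have B: "class_cochain G S b \<in> ?B \<longleftrightarrow>
      (\<exists>p q. \<forall>e\<in>edges G. \<forall>x\<in>e. ?s x e *\<^sub>R (p x - q e) - b {Inl x, Inr e} \<in> S x)" for b
  proof
    assume "class_cochain G S b \<in> ?B"
    then obtain w where w: "w \<in> carrier (C0 ?I ?M)" "coboundary ?I sg ?M w = class_cochain G S b"
      by auto
    obtain p q where pq: "\<forall>e\<in>edges G. \<forall>x\<in>e. w (Inl x) = p x +o S x"
        "\<forall>e\<in>edges G. w (Inr e) = q e +o edge_space S e"
      using rep[OF w(1)] by blast
    have "\<forall>e\<in>edges G. \<forall>x\<in>e. ?s x e *\<^sub>R (p x - q e) - b {Inl x, Inr e} \<in> S x"
      using w(2) by (subst (asm) cob) (use pq in auto)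
    then show "\<exists>p q. \<forall>e\<in>edges G. \<forall>x\<in>e. ?s x e *\<^sub>R (p x - q e) - b {Inl x, Inr e} \<in> S x"
      by blast
  next
    assume "\<exists>p q. \<forall>e\<in>edges G. \<forall>x\<in>e. ?s x e *\<^sub>R (p x - q e) - b {Inl x, Inr e} \<in> S x"
    then obtain p q where
      pq: "\<forall>e\<in>edges G. \<forall>x\<in>e. ?s x e *\<^sub>R (p x - q e) - b {Inl x, Inr e} \<in> S x"
      by blast
    have "coboundary ?I sg ?M (?w p q) = class_cochain G S b"
      by (rule iffD2[OF cob pq]) (erule wl wr, assumption?)+
    then show "class_cochain G S b \<in> ?B" by (rule image_eqI[OF sym wC])
  qed
  have "class_cochain G S (\<lambda>_. 0) \<in> ?B"
  proof -
    have "\<forall>e\<in>edges G. \<forall>x\<in>e. ?s x e *\<^sub>R ((\<lambda>_. 0) x - (\<lambda>_. 0) e) - 0 \<in> S x"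
      by (simp add: subspace_0[OF sub])
    then show ?thesis unfolding B by (intro exI)
  qed
  moreover have "?B \<subseteq> range (class_cochain G S)"
  proof
    fix f assume "f \<in> ?B"
    then obtain w where w: "w \<in> carrier (C0 ?I ?M)" "f = coboundary ?I sg ?M w" by auto
    obtain p q where pq: "\<forall>e\<in>edges G. \<forall>x\<in>e. w (Inl x) = p x +o S x"
        "\<forall>e\<in>edges G. w (Inr e) = q e +o edge_space S e"
      using rep[OF w(1)] by blast
    \<comment> \<open>The vectors computed by \<open>coboundary_motion\<close>, as a function of the
      incidence \<open>i\<close> alone: \<open>base_vertex\<close> and the definite description
      recover its two ends.\<close>
    define b where "b i = sg (Inl (base_vertex i)) i *\<^sub>R
      (p (base_vertex i) - q (THE e. Inr e \<in> i))" for i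
    have "f = class_cochain G S b"
      unfolding w(2) by (subst cob[of w p q]) (use pq in \<open>auto simp: b_def intro: subspace_0 sub\<close>)
    then show "f \<in> range (class_cochain G S)" by blast
  qed
  ultimately have "zero_module (H1 ?I sg ?M) \<longleftrightarrow> range (class_cochain G S) \<subseteq> ?B"
    by (intro H1_motion_zero_iff_surj sub)
  also have "\<dots> \<longleftrightarrow> (\<forall>b. class_cochain G S b \<in> ?B)" by blast
  also have "\<dots> \<longleftrightarrow> (\<forall>b. \<exists>p q. \<forall>e\<in>edges G. \<forall>x\<in>e.
      ?s x e *\<^sub>R (p x - q e) - b {Inl x, Inr e} \<in> S x)"
    by (simp only: B)
  also have "\<dots> \<longleftrightarrow> (\<forall>b. \<exists>p q. \<forall>e\<in>edges G. \<forall>x\<in>e. p x - q e - b x e \<in> S x)"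
  proof -
    \<comment> \<open>The two vectors coincide for sign \<open>1\<close> and are negatives of each
      other for sign \<open>-1\<close>; a subspace does not distinguish these.\<close>
    have sgn: "?s x e *\<^sub>R (p x - q e) - y \<in> S x \<longleftrightarrow> p x - q e - ?s x e *\<^sub>R y \<in> S x"
      if "e \<in> edges G" "x \<in> e" for p q y and x e
    proof -
      have "subspace (S x)" using sub that by blast
      then have "z \<in> S x \<longleftrightarrow> - z \<in> S x" for z
        using subspace_neg[of "S x" z] subspace_neg[of "S x" "- z"] by auto
      from this[of "p x - q e + y"] show ?thesis using s1[OF that] by (auto simp: algebra_simps)
    qed
    show ?thesis
    proof (intro iffI allI)
      fix b assume "\<forall>b. \<exists>p q. \<forall>e\<in>edges G. \<forall>x\<in>e. ?s x e *\<^sub>R (p x - q e) - b {Inl x, Inr e} \<in> S x"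
      \<comment> \<open>The target family is multiplied by the sign in advance; \<open>sgn\<close>
        multiplies by it once more, and the square of a sign is \<open>1\<close>.\<close>
      from this[rule_format, of "\<lambda>i. sg (Inl (base_vertex i)) i *\<^sub>R
          b (base_vertex i) (THE e. Inr e \<in> i)"]
      obtain p q where "\<forall>e\<in>edges G. \<forall>x\<in>e. ?s x e *\<^sub>R (p x - q e) - ?s x e *\<^sub>R b x e \<in> S x"
        by auto
      moreover have "?s x e *\<^sub>R ?s x e *\<^sub>R b x e = b x e" if "e \<in> edges G" "x \<in> e" for e x
        using s1[OF that] by auto
      ultimately have "\<forall>e\<in>edges G. \<forall>x\<in>e. p x - q e - b x e \<in> S x"
        by (metis sgn)
      then show "\<exists>p q. \<forall>e\<in>edges G. \<forall>x\<in>e. p x - q e - b x e \<in> S x" by blast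
    next
      fix b assume "\<forall>b. \<exists>p q. \<forall>e\<in>edges G. \<forall>x\<in>e. p x - q e - b x e \<in> S x"
      from this[rule_format, of "\<lambda>x e. ?s x e *\<^sub>R b {Inl x, Inr e}"]
      show "\<exists>p q. \<forall>e\<in>edges G. \<forall>x\<in>e. ?s x e *\<^sub>R (p x - q e) - b {Inl x, Inr e} \<in> S x"
        using sgn by simp
    qed
  qed
  finally show ?thesis .
qed

section \<open>The extension\<close>

text \<open>Replaces the numbering of the new edges by the set of new neighbours of
  \<open>vs\<close>: odd labels up to \<open>2 * k\<close> give the \<open>u i\<close>, even ones
  the \<open>u' i\<close>, and larger ones the \<open>v j\<close>.\<close>

lemma extension_edges:
  assumes "k \<le> d"
  shows "extension_edge k u u' v vs ` {1..d + k} =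
    (\<lambda>x. {x, vs}) ` (u ` {1..k} \<union> u' ` {1..k} \<union> v ` {1..d - k})" (is "?L = ?R")
proof
  show "?L \<subseteq> ?R"
  proof
    fix e assume "e \<in> ?L"
    then obtain m where m: "m \<in> {1..d + k}" "e = extension_edge k u u' v vs m" by auto
    consider "m \<le> 2 * k" "odd m" | "m \<le> 2 * k" "even m" | "m > 2 * k" by linarith
    then show "e \<in> ?R"
    proof cases
      case 1
      then have "(m + 1) div 2 \<in> {1..k}" by (auto elim!: oddE)
      then show ?thesis using 1 m by (auto simp: extension_edge_def)
    next
      case 2
      then have "m div 2 \<in> {1..k}" using m by (auto elim!: evenE)
      then show ?thesis using 2 m by (auto simp: extension_edge_def)
    next
      case 3
      then have "m - 2 * k \<in> {1..d - k}" using m by auto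
      then show ?thesis using 3 m by (auto simp: extension_edge_def)
    qed
  qed
next
  have "{u i, vs} \<in> ?L" "{u' i, vs} \<in> ?L" if "i \<in> {1..k}" for i
  proof -
    have "extension_edge k u u' v vs (2 * i - 1) = {u i, vs}"
      "extension_edge k u u' v vs (2 * i) = {u' i, vs}"
      using that by (auto simp: extension_edge_def)
    \<comment> \<open>Here \<open>k \<le> d\<close> enters: the labels are at most
      \<open>2 * k\<close>, hence at most \<open>d + k\<close>.\<close>
    moreover have "2 * i - 1 \<in> {1..d + k}" "2 * i \<in> {1..d + k}" using that assms by auto
    ultimately show "{u i, vs} \<in> ?L" "{u' i, vs} \<in> ?L" by (metis imageI)+
  qed
  moreover have "{v j, vs} \<in> ?L" if "j \<in> {1..d - k}" for j
  proof -
    have "extension_edge k u u' v vs (2 * k + j) = {v j, vs}"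
      using that by (auto simp: extension_edge_def)
    moreover have "2 * k + j \<in> {1..d + k}" using that assms by auto
    ultimately show ?thesis by (metis imageI)
  qed
  ultimately show "?R \<subseteq> ?L" by blast
qed

theorem mainTheorem6:
  fixes G G' :: "'a graph"
    and S S' :: "'a \<Rightarrow> 'v::real_vector set"
    and n s d k :: nat
    and u u' v :: "nat \<Rightarrow> 'a"
    and vs :: 'a
    and sg sg' :: "'a + 'a set \<Rightarrow> ('a + 'a set) set \<Rightarrow> real"
  assumes "finite_graph G"
    and "\<exists>B::'v set. finite B \<and> span B = UNIV" and "dim (UNIV :: 'v set) = n"
    and "\<forall>x\<in>verts G. subspace (S x) \<and> dim (S x) = s"
    and "incidence_signs (incidence_graph G) sg"
    and "zero_module (H1 (incidence_graph G) sg (motion_sheaf S))"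
    and "1 \<le> d" and "k \<le> d"
    and "k_extension d k u u' v vs G G'"
    and "\<forall>x\<in>verts G. S' x = S x"
    and "subspace (S' vs)" and "dim (S' vs) = s"
    and "\<forall>i\<in>{1..k}. S' vs + S (u i) = S' vs + S (u' i)
                    \<and> S' vs + S (u' i) = S (u i) + S (u' i)"
    and "\<forall>j\<in>{1..d - k}.
           ((\<Inter>i\<in>{1..d - k} - {j}. S (v i) + S' vs) \<inter> (\<Inter>i\<in>{1..k}. S (u i) + S (u' i)))
             + S (v j) = UNIV"
    and "\<forall>j\<in>{1..k}.
           ((\<Inter>i\<in>{1..d - k}. S (v i) + S' vs) \<inter> (\<Inter>i\<in>{1..k} - {j}. S (u i) + S (u' i)))
             + S (u j) = UNIV"
    and "incidence_signs (incidence_graph G') sg'"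
  shows "zero_module (H1 (incidence_graph G') sg' (motion_sheaf S'))"
proof -
  note fg = assms(1) and subS = assms(4) and sg = assms(5) and H = assms(6) and kd = assms(8)
    and ext = assms(9) and SS = assms(10) and subT = assms(11) and sums = assms(13)
    and covv = assms(14) and covu = assms(15) and sg' = assms(16)
  let ?D = "(\<lambda>i. {u i, u' i}) ` {1..k}"
  let ?N = "u ` {1..k} \<union> u' ` {1..k} \<union> v ` {1..d - k}"
  let ?W = "\<lambda>i. S (u i) + S (u' i)"
  have ev: "e \<subseteq> verts G" if "e \<in> edges G" for e
    using fg that by (auto simp: finite_graph_def)
  have sv: "subspace (S x)" if "x \<in> verts G" for x using subS that by blast
  have ue: "{u i, u' i} \<in> edges G" if "i \<in> {1..k}" for i
    using ext that by (auto simp: k_extension_def)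
  have uv: "u i \<in> verts G" "u' i \<in> verts G" if "i \<in> {1..k}" for i
    using ev[OF ue[OF that]] by auto
  have vv: "v j \<in> verts G" if "j \<in> {1..d - k}" for j
    using ext that by (auto simp: k_extension_def)
  have vs: "vs \<notin> verts G" and verts': "verts G' = insert vs (verts G)"
    and edges': "edges G' = (edges G - ?D) \<union> (\<lambda>x. {x, vs}) ` ?N"
    using ext by (auto simp only: k_extension_def extension_edges[OF kd])
  have N: "?N \<subseteq> verts G" using uv vv by blast
  have ev': "e \<subseteq> verts G'" if "e \<in> edges G'" for e
    using that ev N by (auto simp: edges' verts')
  have sv': "subspace (S' x)" if "x \<in> verts G'" for x
    using that sv SS subT by (auto simp: verts')
  have subW: "subspace (?W i)" if "i \<in> {1..k}" for i
    using subspace_set_plus sv uv[OF that] by blast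
  have G_solvable: "\<forall>b. \<exists>p q. \<forall>e\<in>edges G. \<forall>x\<in>e. p x - q e - b x e \<in> S x"
    using H by (subst (asm) H1_motion_zero_iff) (use ev sv sg in blast)+
  have "\<forall>b'. \<exists>p q. \<forall>e\<in>edges G'. \<forall>x\<in>e. p x - q e - b' x e \<in> S' x"
  proof
    fix b' :: "'a \<Rightarrow> 'a set \<Rightarrow> 'v"
    \<comment> \<open>On a new edge \<open>{x, vs}\<close>, eliminating the edge unknown leaves one
      condition: \<open>p x - g x - r\<close> lies in \<open>S x + S' vs\<close>, where
      \<open>r\<close> is the value at \<open>vs\<close>. So \<open>g x\<close> is the prescribed
      difference between \<open>x\<close> and \<open>vs\<close>.\<close>
    define g where "g x = b' x {x, vs} - b' vs {x, vs}" for x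
    \<comment> \<open>Surviving edges keep their data. A deleted edge receives \<open>g\<close> at
      both ends, so that its two conditions make \<open>p (u i) - g (u i)\<close> and
      \<open>p (u' i) - g (u' i)\<close> agree modulo \<open>?W i\<close>.\<close>
    obtain p q where pq: "\<And>e x. e \<in> edges G \<Longrightarrow> x \<in> e \<Longrightarrow>
        p x - q e - (if e \<in> ?D then g x else b' x e) \<in> S x"
      using G_solvable[rule_format, of "\<lambda>x e. if e \<in> ?D then g x else b' x e"] by blast
    \<comment> \<open>The disjoint sum indexes the \<open>d\<close> conditions on \<open>r\<close>:
      one per \<open>v j\<close> and one per deleted edge. Removing one index leaves precisely the
      intersections in (ii) and (iii).\<close>
    define A where "A = {1..d - k} <+> {1..k}"
    define W where "W = case_sum (\<lambda>j. S (v j) + S' vs) ?W"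
    have "\<exists>r. \<forall>a\<in>A. case_sum (\<lambda>j. p (v j) - g (v j)) (\<lambda>i. p (u i) - g (u i)) a - r \<in> W a"
    proof (rule simultaneous_cosets)
      show "finite A" by (simp add: A_def)
    next
      fix a assume "a \<in> A"
      then show "subspace (W a)"
        using subW subspace_set_plus[OF _ subT] sv vv by (auto simp: A_def W_def)
    next
      fix a assume a: "a \<in> A"
      \<comment> \<open>The covering hypotheses use the summands \<open>S (v j)\<close> and
        \<open>S (u i)\<close>, which are contained in \<open>W a\<close>; enlarging a summand keeps
        the sum equal to \<open>UNIV\<close>.\<close>
      have UNIVI: "C + E = UNIV" if "B + F = UNIV" "B \<subseteq> C" "F \<subseteq> E" for B C E F :: "'v set"
        using set_plus_mono2[OF that(2,3)] that(1) by auto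
      from a consider j where "j \<in> {1..d - k}" "a = Inl j" | i where "i \<in> {1..k}" "a = Inr i"
        unfolding A_def by blast
      then show "(\<Inter>b\<in>A - {a}. W b) + W a = UNIV"
      proof cases
        case j: 1
        show ?thesis
        proof (rule UNIVI[OF covv[rule_format, OF j(1)]])
          show "S (v j) \<subseteq> W a"
            using subspace_0[OF subT] j by (force simp: W_def set_plus_def)
        qed (auto simp: W_def A_def j)
      next
        case i: 2
        show ?thesis
        proof (rule UNIVI[OF covu[rule_format, OF i(1)]])
          show "S (u i) \<subseteq> W a"
            using subspace_0[OF sv[OF uv(2)[OF i(1)]]] i by (force simp: W_def set_plus_def)
        qed (auto simp: W_def A_def i)
      qed
    qed
    then obtain r where r: "\<forall>a\<in>A. case_sum (\<lambda>j. p (v j) - g (v j)) (\<lambda>i. p (u i) - g (u i)) a - r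
        \<in> W a" by blast
    have rv: "j \<in> {1..d - k} \<Longrightarrow> p (v j) - g (v j) - r \<in> S (v j) + S' vs" for j
      using r[unfolded A_def, rule_format, OF InlI] by (simp add: W_def)
    have ru: "i \<in> {1..k} \<Longrightarrow> p (u i) - g (u i) - r \<in> ?W i" for i
      using r[unfolded A_def, rule_format, OF InrI] by (simp add: W_def)
    \<comment> \<open>The condition at \<open>u' i\<close> comes for free: subtracting the two
      conditions on the deleted edge cancels its \<open>q\<close>, and the result turns
      \<open>ru\<close> into the claim.\<close>
    have ru': "p (u' i) - g (u' i) - r \<in> ?W i" if i: "i \<in> {1..k}" for i
    proof -
      have D: "{u i, u' i} \<in> ?D" using i by blast
      have "p (u i) - q {u i, u' i} - g (u i) \<in> S (u i)"
        using pq[OF ue[OF i], of "u i"] D by simp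
      moreover have "p (u' i) - q {u i, u' i} - g (u' i) \<in> S (u' i)"
        using pq[OF ue[OF i], of "u' i"] D by simp
      then have "- (p (u' i) - q {u i, u' i} - g (u' i)) \<in> S (u' i)"
        by (rule subspace_neg[OF sv[OF uv(2)[OF i]]])
      ultimately have "(p (u i) - q {u i, u' i} - g (u i)) + - (p (u' i) - q {u i, u' i} - g (u' i))
          \<in> ?W i"
        by (rule set_plus_intro)
      from subspace_diff[OF subW[OF i] ru[OF i] this] show ?thesis
        by (simp add: algebra_simps)
    qed
    \<comment> \<open>By (i), the modulus \<open>?W i\<close> is the one that the new edges at
      \<open>u i\<close> and \<open>u' i\<close> require.\<close>
    have "S (u i) + S' vs = ?W i" "S (u' i) + S' vs = ?W i" if "i \<in> {1..k}" for i
      using sums that by (metis add.commute)+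
    then have new: "p x - g x - r \<in> S x + S' vs" if "x \<in> ?N" for x
      using that rv ru ru' by blast
    \<comment> \<open>Once the vertex values are fixed, each edge has its own unknown, so
      \<open>q\<close> can be chosen edge by edge.\<close>
    have "\<exists>y. \<forall>x\<in>e. (p(vs := r)) x - y - b' x e \<in> S' x" if e: "e \<in> edges G'" for e
    proof -
      consider "e \<in> edges G - ?D" | x where "e = {x, vs}" "x \<in> ?N"
        using e unfolding edges' by blast
      then show ?thesis
      proof cases
        case 1
        \<comment> \<open>A surviving edge keeps its old \<open>q e\<close>: it does not contain
          \<open>vs\<close>, and its data in \<open>pq\<close> are those of
          \<open>b'\<close>.\<close>
        then have "\<forall>x\<in>e. (p(vs := r)) x - q e - b' x e \<in> S' x"
          using pq[of e] ev[of e] vs SS by (auto split: if_splits)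
        then show ?thesis by blast
      next
        case x: 2
        then have "x \<in> verts G" "p x - g x - r \<in> S x + S' vs" using N new by blast+
        \<comment> \<open>Unfolding \<open>g\<close> separates the contributions of the two ends, so
          the new edge value \<open>y\<close> is a common point of a coset of \<open>S x\<close> and
          a coset of \<open>S' vs\<close>.\<close>
        moreover have "p x - g x - r = (p x - b' x e) - (r - b' vs e)"
          by (simp add: g_def x(1))
        ultimately obtain y where "p x - b' x e - y \<in> S x" "r - b' vs e - y \<in> S' vs"
          using common_point_of_cosets[OF subT] by metis
        then have "\<forall>z\<in>e. (p(vs := r)) z - y - b' z e \<in> S' z"
          using \<open>x \<in> verts G\<close> vs SS by (auto simp: x(1) algebra_simps)
        then show ?thesis by blast
      qed
    qed
    then show "\<exists>p q. \<forall>e\<in>edges G'. \<forall>x\<in>e. p x - q e - b' x e \<in> S' x"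
      by metis
  qed
  then show ?thesis
    by (subst H1_motion_zero_iff) (use ev' sv' sg' in blast)+
qed

end
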